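(* For any preframe $P$ the complete lattice $\mathrm{Nuc}(P)$ of all nuclei on $P$ is a frame.
   Context: A dcpo is a poset in which every directed (in particular nonempty) subset has a join. A preframe is a dcpo $P$ that is also a meet-semilattice (every two elements have a meet; a top element is not required) and in which $x\wedge\bigvee Y=\bigvee_{y\in Y}(x\wedge y)$ for every $x\in P$ and every directed $Y\subseteq P$. A frame is a complete lattice in which $x\wedge\bigvee Y=\bigvee_{y\in Y}(x\wedge y)$ for every element $x$ and every subset $Y$. A nucleus on a meet-semilattice $P$ is a map $\gamma:P\to P$ that is increasing, ascending ($x\le\gamma(x)$ for all $x$), idempotent, and preserves binary meets. $\mathrm{Nuc}(P)$ is ordered pointwise; for a preframe $P$ it is a complete lattice. *)

theory Defs
  imports "HOL-Algebra.Complete_Lattice" "HOL-Library.FuncSet"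
begin

text \<open>
  Posets are \<open>partial_order\<close> structures of HOL-Algebra, which may have an empty carrier.
\<close>

definition directed_subset :: "('a, 'b) gorder_scheme \<Rightarrow> 'a set \<Rightarrow> bool" where
  "directed_subset L Y \<longleftrightarrow>
     Y \<subseteq> carrier L \<and> Y \<noteq> {} \<and> (\<forall>x\<in>Y. \<forall>y\<in>Y. \<exists>z\<in>Y. x \<sqsubseteq>\<^bsub>L\<^esub> z \<and> y \<sqsubseteq>\<^bsub>L\<^esub> z)"

locale dcpo = partial_order +
  assumes directed_sup_exists: "directed_subset L Y \<Longrightarrow> \<exists>s. is_lub L s Y"

text \<open>
  In the next two distributive laws the join on the right is a genuine one: the family
  \<open>x \<sqinter> y\<close> (\<open>y \<in> Y\<close>) is again directed in the first case, and all joins exist in the second.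
\<close>

locale preframe = dcpo + lower_semilattice +
  assumes inf_directed_sup:
    "\<lbrakk>x \<in> carrier L; directed_subset L Y\<rbrakk> \<Longrightarrow> x \<sqinter> \<Squnion>Y = \<Squnion>((\<lambda>y. x \<sqinter> y) ` Y)"

locale frame = complete_lattice +
  assumes inf_sup:
    "\<lbrakk>x \<in> carrier L; Y \<subseteq> carrier L\<rbrakk> \<Longrightarrow> x \<sqinter> \<Squnion>Y = \<Squnion>((\<lambda>y. x \<sqinter> y) ` Y)"

definition nucleus :: "('a, 'b) gorder_scheme \<Rightarrow> ('a \<Rightarrow> 'a) \<Rightarrow> bool" where
  "nucleus P \<gamma> \<longleftrightarrow>
     \<gamma> \<in> carrier P \<rightarrow> carrier P \<and>
     Mono\<^bsub>P\<^esub> \<gamma> \<and>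
     (\<forall>x\<in>carrier P. x \<sqsubseteq>\<^bsub>P\<^esub> \<gamma> x) \<and>
     Idem\<^bsub>P\<^esub> \<gamma> \<and>
     (\<forall>x\<in>carrier P. \<forall>y\<in>carrier P. \<gamma> (x \<sqinter>\<^bsub>P\<^esub> y) = \<gamma> x \<sqinter>\<^bsub>P\<^esub> \<gamma> y)"

text \<open>
  Maps are taken extensional, i.e. \<open>undefined\<close> outside the carrier, so that a map on the
  carrier is represented by exactly one HOL function and the pointwise order is antisymmetric.
\<close>

definition Nuc :: "('a, 'b) gorder_scheme \<Rightarrow> ('a \<Rightarrow> 'a) gorder" where
  "Nuc P =
     \<lparr>carrier = {\<gamma> \<in> extensional (carrier P). nucleus P \<gamma>},
      eq = (=),
      le = (\<lambda>\<gamma> \<delta>. \<forall>x\<in>carrier P. \<gamma> x \<sqsubseteq>\<^bsub>P\<^esub> \<delta> x)\<rparr>"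

end

theory Submission
  imports Defs
begin

text \<open>
  Call a map a prenucleus if it satisfies all conditions on a nucleus except idempotence. A set
  \<open>T\<close> of prenuclei that contains the identity and is closed under composition is
  pointwise directed, because \<open>f \<circ> g\<close> lies above both \<open>f\<close> and \<open>g\<close>;
  hence its pointwise join \<open>t\<close> is a prenucleus. If moreover \<open>t \<in> T\<close>, then
  \<open>t \<circ> t \<in> T\<close> gives \<open>t \<circ> t \<le> t\<close>, and \<open>t\<close> is a nucleus. No transfinite
  iteration is needed.

  For a set \<open>G\<close> of nuclei, the prenuclei below every nucleus that bounds \<open>G\<close> form such
  a \<open>T\<close>, and \<open>t\<close> is the join of \<open>G\<close>. If \<open>\<theta>\<close> bounds all \<open>\<gamma> \<sqinter> g\<close> with
  \<open>g \<in> G\<close>, the prenuclei \<open>f\<close> with \<open>\<gamma> x \<sqinter> f x \<le> \<theta> x\<close> for all \<open>x\<close> form another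
  such \<open>T\<close>, and here \<open>t\<close> is a nucleus that bounds \<open>G\<close>, so that
  \<open>\<gamma> \<sqinter> \<Squnion>G \<le> \<gamma> \<sqinter> t \<le> \<theta>\<close>.
\<close>

section \<open>Prenuclei on a meet-semilattice\<close>

definition prenucleus :: "('a, 'b) gorder_scheme \<Rightarrow> ('a \<Rightarrow> 'a) \<Rightarrow> bool" where
  "prenucleus P f \<longleftrightarrow>
     f \<in> carrier P \<rightarrow> carrier P \<and>
     (\<forall>x\<in>carrier P. x \<sqsubseteq>\<^bsub>P\<^esub> f x) \<and>
     (\<forall>x\<in>carrier P. \<forall>y\<in>carrier P. f (x \<sqinter>\<^bsub>P\<^esub> y) = f x \<sqinter>\<^bsub>P\<^esub> f y)"

text \<open>The restriction to the carrier makes the map extensional, so that it can belong to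
  \<open>Nuc P\<close> although members of \<open>T\<close>, such as \<open>id\<close>, need not be
  extensional.\<close>

definition pointwise_sup :: "('a, 'b) gorder_scheme \<Rightarrow> ('a \<Rightarrow> 'a) set \<Rightarrow> 'a \<Rightarrow> 'a" where
  "pointwise_sup P T = (\<lambda>x\<in>carrier P. \<Squnion>\<^bsub>P\<^esub>((\<lambda>f. f x) ` T))"

lemma prenucleus_closed: "\<lbrakk>prenucleus P f; x \<in> carrier P\<rbrakk> \<Longrightarrow> f x \<in> carrier P"
  by (auto simp: prenucleus_def)

lemma prenucleus_ascending: "\<lbrakk>prenucleus P f; x \<in> carrier P\<rbrakk> \<Longrightarrow> x \<sqsubseteq>\<^bsub>P\<^esub> f x"
  by (auto simp: prenucleus_def)

lemma prenucleus_meet: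
  "\<lbrakk>prenucleus P f; x \<in> carrier P; y \<in> carrier P\<rbrakk> \<Longrightarrow> f (x \<sqinter>\<^bsub>P\<^esub> y) = f x \<sqinter>\<^bsub>P\<^esub> f y"
  by (auto simp: prenucleus_def)

text \<open>\<open>\<Squnion>\<close> is a choice among least upper bounds; directedness guarantees
  that there is one to choose.\<close>

lemma (in dcpo) directed_sup_lub:
  assumes "directed_subset L Y"
  shows "is_lub L (\<Squnion>Y) Y"
  unfolding sup_def using directed_sup_exists[OF assms] by (rule someI_ex)

lemma (in lower_semilattice) meet_absorb:
  assumes "x \<in> carrier L" "y \<in> carrier L" "x \<sqsubseteq> y"
  shows "x \<sqinter> y = x"
  using assms by (intro le_antisym meet_left meet_le) auto

lemma (in lower_semilattice) meet_mono:
  assumes "x \<sqsubseteq> x'" "y \<sqsubseteq> y'"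
    and "x \<in> carrier L" "y \<in> carrier L" "x' \<in> carrier L" "y' \<in> carrier L"
  shows "x \<sqinter> y \<sqsubseteq> x' \<sqinter> y'"
proof (rule meet_le)
  show "x \<sqinter> y \<sqsubseteq> x'"
    using le_trans[OF meet_left assms(1)] assms by simp
  show "x \<sqinter> y \<sqsubseteq> y'"
    using le_trans[OF meet_right assms(2)] assms by simp
qed (use assms in simp_all)

text \<open>If \<open>x \<sqsubseteq> y\<close> then \<open>x\<close> is the meet of
  \<open>x\<close> and \<open>y\<close>, and \<open>f\<close> preserves this meet.\<close>

lemma (in lower_semilattice) prenucleus_mono:
  assumes f: "prenucleus L f" and x: "x \<in> carrier L" and y: "y \<in> carrier L" and le: "x \<sqsubseteq> y"
  shows "f x \<sqsubseteq> f y"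
proof -
  have "f x = f x \<sqinter> f y"
    using prenucleus_meet[OF f x y] meet_absorb[OF x y le] by simp
  then show ?thesis
    using meet_right[OF prenucleus_closed[OF f x] prenucleus_closed[OF f y]] by simp
qed

lemma (in lower_semilattice) nucleus_iff_prenucleus:
  "nucleus L f \<longleftrightarrow> prenucleus L f \<and> (\<forall>x\<in>carrier L. f (f x) = f x)"
proof -
  have "Mono f" if "prenucleus L f"
    using prenucleus_mono[OF that] by (auto intro: isotoneI weak_partial_order_axioms)
  then show ?thesis
    by (auto simp: nucleus_def prenucleus_def idempotent_def eq_is_equal)
qed

lemma (in lower_semilattice) prenucleus_id: "prenucleus L id"
  by (auto simp: prenucleus_def)

lemma (in lower_semilattice) prenucleus_comp:
  assumes "prenucleus L f" "prenucleus L g"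
  shows "prenucleus L (f \<circ> g)"
  unfolding prenucleus_def
proof (intro conjI ballI)
  show "f \<circ> g \<in> carrier L \<rightarrow> carrier L"
    using assms by (auto simp: prenucleus_def)
next
  fix x assume x: "x \<in> carrier L"
  note gx = prenucleus_closed[OF assms(2) x]
  show "x \<sqsubseteq> (f \<circ> g) x"
    using le_trans[OF prenucleus_ascending[OF assms(2) x] prenucleus_ascending[OF assms(1) gx] x gx]
      prenucleus_closed[OF assms(1) gx] by simp
next
  fix x y assume x: "x \<in> carrier L" and y: "y \<in> carrier L"
  show "(f \<circ> g) (x \<sqinter> y) = (f \<circ> g) x \<sqinter> (f \<circ> g) y"
    using prenucleus_meet[OF assms(2) x y] prenucleus_closed[OF assms(2)] x y
    by (simp add: prenucleus_meet[OF assms(1)])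
qed

section \<open>Meets with directed joins\<close>

context preframe
begin

text \<open>The distributive law is an equation between two values of \<open>\<Squnion>\<close>. It
  yields a bound once the family of all \<open>x \<sqinter> y\<close> is shown to be directed,
  because its \<open>\<Squnion>\<close> is then a true least upper bound.\<close>

lemma inf_directed_sup_le:
  assumes x: "x \<in> carrier L" and Y: "directed_subset L Y" and u: "u \<in> carrier L"
    and le: "\<And>y. y \<in> Y \<Longrightarrow> x \<sqinter> y \<sqsubseteq> u"
  shows "x \<sqinter> \<Squnion>Y \<sqsubseteq> u"
proof -
  have Yc: "Y \<subseteq> carrier L"
    using Y by (simp add: directed_subset_def)
  have "directed_subset L ((\<lambda>y. x \<sqinter> y) ` Y)"
    unfolding directed_subset_def
  proof (intro conjI ballI)
    show "(\<lambda>y. x \<sqinter> y) ` Y \<subseteq> carrier L" "(\<lambda>y. x \<sqinter> y) ` Y \<noteq> {}"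
      using x Yc Y by (auto simp: directed_subset_def)
  next
    fix a b assume "a \<in> (\<lambda>y. x \<sqinter> y) ` Y" "b \<in> (\<lambda>y. x \<sqinter> y) ` Y"
    then obtain y z where yz: "y \<in> Y" "z \<in> Y" "a = x \<sqinter> y" "b = x \<sqinter> z"
      by auto
    then obtain w where w: "w \<in> Y" "y \<sqsubseteq> w" "z \<sqsubseteq> w"
      using Y unfolding directed_subset_def by blast
    have "y \<in> carrier L" "z \<in> carrier L" "w \<in> carrier L"
      using w yz Yc by auto
    then have "a \<sqsubseteq> x \<sqinter> w" "b \<sqsubseteq> x \<sqinter> w"
      using w yz x by (simp_all add: meet_mono)
    then show "\<exists>c\<in>(\<lambda>y. x \<sqinter> y) ` Y. a \<sqsubseteq> c \<and> b \<sqsubseteq> c"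
      using w(1) by blast
  qed
  from directed_sup_lub[OF this] have "\<Squnion>((\<lambda>y. x \<sqinter> y) ` Y) \<sqsubseteq> u"
    by (rule least_le) (use u le in \<open>auto simp: Upper_def\<close>)
  then show ?thesis
    using inf_directed_sup[OF x Y] by simp
qed

end

section \<open>Pointwise joins over a monoid of prenuclei\<close>

locale prenucleus_monoid = preframe +
  fixes T :: "('a \<Rightarrow> 'a) set"
  assumes prenuclei: "f \<in> T \<Longrightarrow> prenucleus L f"
    and id_mem: "id \<in> T"
    and comp_mem: "\<lbrakk>f \<in> T; g \<in> T\<rbrakk> \<Longrightarrow> f \<circ> g \<in> T"
begin

lemma directed_values:
  assumes x: "x \<in> carrier L"
  shows "directed_subset L ((\<lambda>f. f x) ` T)"
  unfolding directed_subset_def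
proof (intro conjI ballI)
  show "(\<lambda>f. f x) ` T \<subseteq> carrier L" "(\<lambda>f. f x) ` T \<noteq> {}"
    using prenucleus_closed[OF prenuclei x] id_mem by auto
next
  fix a b assume "a \<in> (\<lambda>f. f x) ` T" "b \<in> (\<lambda>f. f x) ` T"
  then obtain f g where fg: "f \<in> T" "g \<in> T" "a = f x" "b = g x"
    by auto
  note f = prenuclei[OF fg(1)] and g = prenuclei[OF fg(2)]
  have gx: "g x \<in> carrier L"
    by (rule prenucleus_closed[OF g x])
  \<comment> \<open>The first bound is monotonicity of \<open>f\<close> applied to
    \<open>x \<sqsubseteq> g x\<close>; the second is that \<open>f\<close> is ascending at
    \<open>g x\<close>.\<close>
  have "a \<sqsubseteq> (f \<circ> g) x" "b \<sqsubseteq> (f \<circ> g) x"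
    using prenucleus_mono[OF f x gx prenucleus_ascending[OF g x]] prenucleus_ascending[OF f gx] fg
    by auto
  then show "\<exists>c\<in>(\<lambda>f. f x) ` T. a \<sqsubseteq> c \<and> b \<sqsubseteq> c"
    using comp_mem[OF fg(1,2)] by blast
qed

lemma pointwise_sup_lub:
  assumes "x \<in> carrier L"
  shows "is_lub L (pointwise_sup L T x) ((\<lambda>f. f x) ` T)"
  using directed_sup_lub[OF directed_values[OF assms]] assms by (simp add: pointwise_sup_def)

lemma pointwise_sup_closed: "x \<in> carrier L \<Longrightarrow> pointwise_sup L T x \<in> carrier L"
  by (rule least_closed[OF pointwise_sup_lub])

lemma pointwise_sup_upper:
  assumes "f \<in> T" "x \<in> carrier L"
  shows "f x \<sqsubseteq> pointwise_sup L T x"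
  using least_Upper_above[OF pointwise_sup_lub[OF assms(2)], of "f x"]
    directed_values[OF assms(2)] assms by (auto simp: directed_subset_def)

lemma pointwise_sup_least:
  assumes "x \<in> carrier L" "u \<in> carrier L" "\<And>f. f \<in> T \<Longrightarrow> f x \<sqsubseteq> u"
  shows "pointwise_sup L T x \<sqsubseteq> u"
  using pointwise_sup_lub[OF assms(1)] by (rule least_le) (use assms in \<open>auto simp: Upper_def\<close>)

lemma meet_pointwise_sup_le:
  assumes "y \<in> carrier L" "x \<in> carrier L" "u \<in> carrier L"
    and "\<And>f. f \<in> T \<Longrightarrow> y \<sqinter> f x \<sqsubseteq> u"
  shows "y \<sqinter> pointwise_sup L T x \<sqsubseteq> u"
proof -
  have "y \<sqinter> \<Squnion>((\<lambda>f. f x) ` T) \<sqsubseteq> u"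
    by (rule inf_directed_sup_le[OF assms(1) directed_values[OF assms(2)] assms(3)])
      (use assms(4) in auto)
  then show ?thesis
    using assms(2) by (simp add: pointwise_sup_def)
qed

text \<open>The join is ascending because \<open>id\<close> is in \<open>T\<close>. For meets,
  directed distributivity is used once in each argument, which reduces
  \<open>?t x \<sqinter> ?t y\<close> to the meets \<open>f x \<sqinter> g y\<close> with
  \<open>f\<close> and \<open>g\<close> in \<open>T\<close>.\<close>

lemma prenucleus_pointwise_sup: "prenucleus L (pointwise_sup L T)"
proof -
  let ?t = "pointwise_sup L T"
  have meet_values: "f x \<sqinter> g y \<sqsubseteq> ?t (x \<sqinter> y)"
    if fg: "f \<in> T" "g \<in> T" and x: "x \<in> carrier L" and y: "y \<in> carrier L" for f g x y
  proof -
    have xy: "x \<sqinter> y \<in> carrier L"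
      using x y by simp
    \<comment> \<open>Two different maps cannot be pulled through one meet, so both are replaced by
      the larger map \<open>f \<circ> g\<close>, which preserves meets.\<close>
    obtain h where h: "h \<in> T" "f x \<sqsubseteq> h x" "g y \<sqsubseteq> h y"
    proof
      note f = prenuclei[OF fg(1)] and g = prenuclei[OF fg(2)]
      show "f \<circ> g \<in> T"
        by (rule comp_mem[OF fg])
      show "f x \<sqsubseteq> (f \<circ> g) x"
        using prenucleus_mono[OF f x prenucleus_closed[OF g x] prenucleus_ascending[OF g x]] by simp
      show "g y \<sqsubseteq> (f \<circ> g) y"
        using prenucleus_ascending[OF f prenucleus_closed[OF g y]] by simp
    qed
    note closed = prenucleus_closed[OF prenuclei]
    note c = closed[OF fg(1) x] closed[OF fg(2) y] closed[OF h(1) x] closed[OF h(1) y]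
      closed[OF h(1) xy] pointwise_sup_closed[OF xy]
    have "f x \<sqinter> g y \<sqsubseteq> h x \<sqinter> h y"
      by (rule meet_mono[OF h(2,3) c(1-4)])
    also have "h x \<sqinter> h y = h (x \<sqinter> y)"
      using prenucleus_meet[OF prenuclei[OF h(1)] x y] by simp
    also have "h (x \<sqinter> y) \<sqsubseteq> ?t (x \<sqinter> y)"
      by (rule pointwise_sup_upper[OF h(1) xy])
    finally show ?thesis
      using c by simp
  qed
  \<comment> \<open>This gives the easy half of meet preservation. It is proved directly because
    \<open>prenucleus_mono\<close> would already presuppose that \<open>?t\<close> preserves
    meets.\<close>
  have mono: "?t x \<sqsubseteq> ?t y" if x: "x \<in> carrier L" and y: "y \<in> carrier L" and le: "x \<sqsubseteq> y" for x y
  proof (rule pointwise_sup_least[OF x pointwise_sup_closed[OF y]])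
    fix f assume f: "f \<in> T"
    show "f x \<sqsubseteq> ?t y"
      using prenucleus_mono[OF prenuclei[OF f] x y le] pointwise_sup_upper[OF f y]
      by (rule le_trans)
        (use prenucleus_closed[OF prenuclei[OF f]] pointwise_sup_closed x y in simp_all)
  qed
  show ?thesis
    unfolding prenucleus_def
  proof (intro conjI ballI)
    show "?t \<in> carrier L \<rightarrow> carrier L"
      using pointwise_sup_closed by auto
  next
    fix x assume "x \<in> carrier L"
    then show "x \<sqsubseteq> ?t x"
      using pointwise_sup_upper[OF id_mem] by simp
  next
    fix x y assume x: "x \<in> carrier L" and y: "y \<in> carrier L"
    then have xy: "x \<sqinter> y \<in> carrier L"
      by simp
    note c = pointwise_sup_closed[OF x] pointwise_sup_closed[OF y] pointwise_sup_closed[OF xy]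
    show "?t (x \<sqinter> y) = ?t x \<sqinter> ?t y"
    proof (rule le_antisym)
      show "?t (x \<sqinter> y) \<sqsubseteq> ?t x \<sqinter> ?t y"
        using x y xy c by (intro meet_le mono meet_left meet_right) auto
      show "?t x \<sqinter> ?t y \<sqsubseteq> ?t (x \<sqinter> y)"
      proof (rule meet_pointwise_sup_le[OF c(1) y c(3)])
        fix g assume g: "g \<in> T"
        have gy: "g y \<in> carrier L"
          by (rule prenucleus_closed[OF prenuclei[OF g] y])
        have "g y \<sqinter> ?t x \<sqsubseteq> ?t (x \<sqinter> y)"
          by (rule meet_pointwise_sup_le[OF gy x c(3)])
            (use meet_values[OF _ g x y] meet_comm[of L "g y"] in auto)
        then show "?t x \<sqinter> g y \<sqsubseteq> ?t (x \<sqinter> y)"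
          by (simp add: meet_comm[of L "g y"])
      qed
    qed (use c in auto)
  qed
qed

lemma pointwise_sup_in_Nuc:
  assumes "pointwise_sup L T \<in> T"
  shows "pointwise_sup L T \<in> carrier (Nuc L)"
proof -
  let ?t = "pointwise_sup L T"
  have "?t (?t x) = ?t x" if x: "x \<in> carrier L" for x
  proof (rule le_antisym)
    show "?t (?t x) \<sqsubseteq> ?t x"
      using pointwise_sup_upper[OF comp_mem[OF assms assms] x] by simp
    show "?t x \<sqsubseteq> ?t (?t x)"
      using prenucleus_ascending[OF prenucleus_pointwise_sup] pointwise_sup_closed x by auto
  qed (use x in \<open>auto intro!: pointwise_sup_closed\<close>)
  then show ?thesis
    using prenucleus_pointwise_sup
    by (auto simp: Nuc_def nucleus_iff_prenucleus pointwise_sup_def)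
qed

end

section \<open>Completeness of the lattice of nuclei\<close>

context preframe
begin

lemma Nuc_prenucleus: "\<gamma> \<in> carrier (Nuc L) \<Longrightarrow> prenucleus L \<gamma>"
  by (auto simp: Nuc_def nucleus_iff_prenucleus)

lemma Nuc_closed: "\<lbrakk>\<gamma> \<in> carrier (Nuc L); x \<in> carrier L\<rbrakk> \<Longrightarrow> \<gamma> x \<in> carrier L"
  by (rule prenucleus_closed[OF Nuc_prenucleus])

lemma Nuc_idem: "\<lbrakk>\<gamma> \<in> carrier (Nuc L); x \<in> carrier L\<rbrakk> \<Longrightarrow> \<gamma> (\<gamma> x) = \<gamma> x"
  by (auto simp: Nuc_def nucleus_iff_prenucleus)

lemma Nuc_le: "\<gamma> \<sqsubseteq>\<^bsub>Nuc L\<^esub> \<delta> \<longleftrightarrow> (\<forall>x\<in>carrier L. \<gamma> x \<sqsubseteq> \<delta> x)"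
  by (simp add: Nuc_def)

lemma Nuc_partial_order: "partial_order (Nuc L)"
proof
  fix \<gamma> \<delta> :: "'a \<Rightarrow> 'a"
  assume *: "\<gamma> \<sqsubseteq>\<^bsub>Nuc L\<^esub> \<delta>" "\<delta> \<sqsubseteq>\<^bsub>Nuc L\<^esub> \<gamma>" "\<gamma> \<in> carrier (Nuc L)" "\<delta> \<in> carrier (Nuc L)"
  then have "\<gamma> x = \<delta> x" if "x \<in> carrier L" for x
    using that Nuc_closed[OF *(3)] Nuc_closed[OF *(4)] *(1,2)
    by (intro le_antisym) (simp_all add: Nuc_le)
  \<comment> \<open>Extensionality turns agreement on the carrier into equality of
    functions.\<close>
  then have "\<gamma> = \<delta>"
    using *(3,4) by (auto simp: Nuc_def intro: extensionalityI)
  then show "\<gamma> .=\<^bsub>Nuc L\<^esub> \<delta>"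
    by (simp add: Nuc_def)
next
  fix \<gamma> \<delta> \<epsilon> :: "'a \<Rightarrow> 'a"
  assume *: "\<gamma> \<sqsubseteq>\<^bsub>Nuc L\<^esub> \<delta>" "\<delta> \<sqsubseteq>\<^bsub>Nuc L\<^esub> \<epsilon>"
    "\<gamma> \<in> carrier (Nuc L)" "\<delta> \<in> carrier (Nuc L)" "\<epsilon> \<in> carrier (Nuc L)"
  show "\<gamma> \<sqsubseteq>\<^bsub>Nuc L\<^esub> \<epsilon>"
    unfolding Nuc_le
  proof
    fix x assume x: "x \<in> carrier L"
    note c = Nuc_closed[OF *(3) x] Nuc_closed[OF *(4) x] Nuc_closed[OF *(5) x]
    show "\<gamma> x \<sqsubseteq> \<epsilon> x"
      using *(1,2) x by (intro le_trans[OF _ _ c]) (simp_all add: Nuc_le)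
  qed
next
  fix \<gamma> assume "\<gamma> \<in> carrier (Nuc L)"
  then show "\<gamma> \<sqsubseteq>\<^bsub>Nuc L\<^esub> \<gamma>"
    using Nuc_closed by (simp add: Nuc_le)
qed (auto simp: Nuc_def)

lemma Nuc_sup_exists:
  assumes G: "G \<subseteq> carrier (Nuc L)"
  shows "\<exists>s. is_lub (Nuc L) s G"
proof -
  \<comment> \<open>No upper bound of \<open>G\<close> is presupposed: the condition ranges over
    whatever bounds there are, and the join of \<open>T\<close> turns out to be one.\<close>
  define T where
    "T = {f. prenucleus L f \<and> (\<forall>\<delta>\<in>Upper (Nuc L) G. \<forall>x\<in>carrier L. f x \<sqsubseteq> \<delta> x)}"
  have up: "\<delta> \<in> carrier (Nuc L)" if "\<delta> \<in> Upper (Nuc L) G" for \<delta>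
    using that by (simp add: Upper_def)
  interpret T: prenucleus_monoid L T
  proof
    show "prenucleus L f" if "f \<in> T" for f
      using that by (simp add: T_def)
    show "id \<in> T"
      using prenucleus_ascending[OF Nuc_prenucleus[OF up]] by (simp add: T_def prenucleus_id)
    fix f g assume f: "f \<in> T" and g: "g \<in> T"
    have pre: "prenucleus L f" "prenucleus L g"
      using f g by (auto simp: T_def)
    \<comment> \<open>Closure under composition rests on idempotence of the bound:
      \<open>f (g x)\<close> lies below \<open>\<delta> (\<delta> x)\<close>, which is
      \<open>\<delta> x\<close>.\<close>
    have "f (g x) \<sqsubseteq> \<delta> x" if \<delta>: "\<delta> \<in> Upper (Nuc L) G" and x: "x \<in> carrier L" for \<delta> x
    proof -
      note c = prenucleus_closed[OF pre(2) x] Nuc_closed[OF up[OF \<delta>] x]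
      have "g x \<sqsubseteq> \<delta> x"
        using g \<delta> x unfolding T_def by blast
      then have "f (g x) \<sqsubseteq> f (\<delta> x)"
        by (rule prenucleus_mono[OF pre(1) c])
      also have "f (\<delta> x) \<sqsubseteq> \<delta> (\<delta> x)"
        using f \<delta> c unfolding T_def by blast
      finally show ?thesis
        using c Nuc_idem[OF up[OF \<delta>] x] prenucleus_closed[OF pre(1)] by simp
    qed
    then show "f \<circ> g \<in> T"
      using prenucleus_comp[OF pre] by (auto simp: T_def)
  qed
  let ?s = "pointwise_sup L T"
  have below: "?s x \<sqsubseteq> \<delta> x" if "\<delta> \<in> Upper (Nuc L) G" "x \<in> carrier L" for \<delta> x
    by (rule T.pointwise_sup_least[OF that(2) Nuc_closed[OF up[OF that(1)] that(2)]])
      (use that in \<open>auto simp: T_def\<close>)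
  then have "?s \<in> T"
    using T.prenucleus_pointwise_sup by (auto simp: T_def)
  then have s: "?s \<in> carrier (Nuc L)"
    by (rule T.pointwise_sup_in_Nuc)
  \<comment> \<open>Each member of \<open>G\<close> is itself a prenucleus below all bounds of
    \<open>G\<close>, so the join of \<open>T\<close> lies above it.\<close>
  have "g \<in> T" if "g \<in> G" for g
  proof -
    have "prenucleus L g"
      using Nuc_prenucleus that G by blast
    moreover have "g x \<sqsubseteq> \<delta> x" if "\<delta> \<in> Upper (Nuc L) G" "x \<in> carrier L" for \<delta> x
      using Upper_memD[OF that(1) \<open>g \<in> G\<close> G] that(2) by (simp add: Nuc_le)
    ultimately show ?thesis
      by (simp add: T_def)
  qed
  then have "g \<sqsubseteq>\<^bsub>Nuc L\<^esub> ?s" if "g \<in> G" for g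
    using T.pointwise_sup_upper that by (simp add: Nuc_le)
  then have "is_lub (Nuc L) ?s G"
    using below G s by (intro least_UpperI) (simp_all add: Nuc_le)
  then show ?thesis
    by blast
qed

text \<open>Arbitrary joins suffice: the meet of a set is the join of its lower bounds.\<close>

lemma Nuc_complete_lattice: "complete_lattice (Nuc L)"
proof -
  interpret N: partial_order "Nuc L"
    by (rule Nuc_partial_order)
  show ?thesis
  proof
    show "\<exists>s. is_lub (Nuc L) s A" if "A \<subseteq> carrier (Nuc L)" for A
      using that by (rule Nuc_sup_exists)
    fix A assume A: "A \<subseteq> carrier (Nuc L)"
    obtain i where i: "is_lub (Nuc L) i (Lower (Nuc L) A)"
      using Nuc_sup_exists[of "Lower (Nuc L) A"] by auto
    have "is_glb (Nuc L) i A"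
    proof (rule greatest_LowerI)
      show "i \<sqsubseteq>\<^bsub>Nuc L\<^esub> x" if "x \<in> A" for x
        using i by (rule least_le) (use that A in \<open>auto simp: Upper_def Lower_def\<close>)
      show "y \<sqsubseteq>\<^bsub>Nuc L\<^esub> i" if "y \<in> Lower (Nuc L) A" for y
        using least_Upper_above[OF i that] by simp
    qed (use A i in auto)
    then show "\<exists>i. is_glb (Nuc L) i A"
      by blast
  qed
qed

section \<open>Distributivity of pointwise meets over joins of nuclei\<close>

text \<open>For idempotence, applying \<gamma> and \<delta> to
  \<open>\<gamma> x \<sqinter> \<delta> x\<close> produces the extra factors
  \<open>\<gamma> (\<delta> x)\<close> and \<open>\<delta> (\<gamma> x)\<close>. They lie above
  \<open>\<delta> x\<close> and \<open>\<gamma> x\<close> respectively and are absorbed.\<close>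

lemma pointwise_meet_in_Nuc:
  assumes \<gamma>: "\<gamma> \<in> carrier (Nuc L)" and \<delta>: "\<delta> \<in> carrier (Nuc L)"
  shows "(\<lambda>x\<in>carrier L. \<gamma> x \<sqinter> \<delta> x) \<in> carrier (Nuc L)"
proof -
  note pre = Nuc_prenucleus[OF \<gamma>] Nuc_prenucleus[OF \<delta>]
  note closed = prenucleus_closed[OF pre(1)] prenucleus_closed[OF pre(2)]
  \<comment> \<open>This regrouping serves both idempotence and preservation of meets.\<close>
  have interchange: "(a \<sqinter> b) \<sqinter> (c \<sqinter> d) = (a \<sqinter> c) \<sqinter> (b \<sqinter> d)"
    if "a \<in> carrier L" "b \<in> carrier L" "c \<in> carrier L" "d \<in> carrier L" for a b c d
  proof -
    have "(a \<sqinter> b) \<sqinter> (c \<sqinter> d) = a \<sqinter> (b \<sqinter> c \<sqinter> d)"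
      using that by (simp add: meet_assoc)
    also have "b \<sqinter> c = c \<sqinter> b"
      by (rule meet_comm)
    finally show ?thesis
      using that by (simp add: meet_assoc)
  qed
  have "\<gamma> (\<gamma> x \<sqinter> \<delta> x) \<sqinter> \<delta> (\<gamma> x \<sqinter> \<delta> x) = \<gamma> x \<sqinter> \<delta> x" if x: "x \<in> carrier L" for x
  proof -
    note c = closed[OF x]
    have "\<gamma> (\<gamma> x \<sqinter> \<delta> x) = \<gamma> x \<sqinter> \<gamma> (\<delta> x)" "\<delta> (\<gamma> x \<sqinter> \<delta> x) = \<delta> (\<gamma> x) \<sqinter> \<delta> x"
      using prenucleus_meet[OF pre(1) c] prenucleus_meet[OF pre(2) c]
        Nuc_idem[OF \<gamma> x] Nuc_idem[OF \<delta> x] by simp_all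
    moreover have "\<gamma> x \<sqinter> \<delta> (\<gamma> x) = \<gamma> x" "\<delta> x \<sqinter> \<gamma> (\<delta> x) = \<delta> x"
      using meet_absorb[OF _ _ prenucleus_ascending[OF pre(2)]]
        meet_absorb[OF _ _ prenucleus_ascending[OF pre(1)]] c closed by simp_all
    ultimately show ?thesis
      using interchange[of "\<gamma> x" "\<gamma> (\<delta> x)" "\<delta> (\<gamma> x)" "\<delta> x"] c closed
        meet_comm[of L "\<delta> x" "\<gamma> (\<delta> x)"] by simp
  qed
  moreover have "x \<sqsubseteq> \<gamma> x \<sqinter> \<delta> x" if "x \<in> carrier L" for x
    using prenucleus_ascending[OF pre(1) that] prenucleus_ascending[OF pre(2) that] closed that
    by (intro meet_le) simp_all
  ultimately show ?thesis
    using interchange closed prenucleus_meet[OF pre(1)] prenucleus_meet[OF pre(2)]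
    by (auto simp: Nuc_def nucleus_iff_prenucleus prenucleus_def)
qed

text \<open>This is the hard half of the frame law. The pointwise form allows the directed
  distributive law of \<open>L\<close> to be applied at each argument separately.\<close>

lemma Nuc_distrib_le:
  assumes G: "G \<subseteq> carrier (Nuc L)" and s: "is_lub (Nuc L) s G"
    and \<gamma>: "\<gamma> \<in> carrier (Nuc L)" and \<theta>: "\<theta> \<in> carrier (Nuc L)"
    and le: "\<And>g x. \<lbrakk>g \<in> G; x \<in> carrier L\<rbrakk> \<Longrightarrow> \<gamma> x \<sqinter> g x \<sqsubseteq> \<theta> x"
    and x: "x \<in> carrier L"
  shows "\<gamma> x \<sqinter> s x \<sqsubseteq> \<theta> x"
proof -
  define T where "T = {f. prenucleus L f \<and> (\<forall>x\<in>carrier L. \<gamma> x \<sqinter> f x \<sqsubseteq> \<theta> x)}"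
  note pre\<gamma> = Nuc_prenucleus[OF \<gamma>] and pre\<theta> = Nuc_prenucleus[OF \<theta>]
  note c\<gamma> = prenucleus_closed[OF pre\<gamma>] and c\<theta> = prenucleus_closed[OF pre\<theta>]
  interpret T: prenucleus_monoid L T
  proof
    show "prenucleus L f" if "f \<in> T" for f
      using that by (simp add: T_def)
    have "\<gamma> x \<sqinter> x \<sqsubseteq> \<theta> x" if "x \<in> carrier L" for x
      using that c\<gamma> c\<theta>
      by (intro le_trans[OF meet_right prenucleus_ascending[OF pre\<theta>]]) simp_all
    then show "id \<in> T"
      by (auto simp: T_def prenucleus_id)
    fix f h assume f: "f \<in> T" and h: "h \<in> T"
    have pre: "prenucleus L f" "prenucleus L h"
      using f h by (auto simp: T_def)
    note cf = prenucleus_closed[OF pre(1)] and ch = prenucleus_closed[OF pre(2)]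
    have "\<gamma> x \<sqinter> f (h x) \<sqsubseteq> \<theta> x" if x: "x \<in> carrier L" for x
    proof -
      \<comment> \<open>The condition on \<open>f\<close> is used at \<open>z\<close> instead of
        \<open>h x\<close>: \<open>z\<close> lies below \<open>\<theta> x\<close> because
        \<open>h\<close> is in \<open>T\<close>, whereas \<open>h x\<close> need not. Nothing is
        lost on the side of \<gamma>, since \<open>\<gamma> z = \<gamma> x\<close>.\<close>
      define z where "z = \<gamma> x \<sqinter> h x"
      note c = x c\<gamma>[OF x] ch[OF x] c\<theta>[OF x]
      have z: "z \<in> carrier L"
        using c by (simp add: z_def)
      have "\<gamma> x \<sqsubseteq> \<gamma> (h x)"
        using prenucleus_mono[OF pre\<gamma> x ch[OF x] prenucleus_ascending[OF pre(2) x]] .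
      then have \<gamma>z: "\<gamma> z = \<gamma> x"
        using prenucleus_meet[OF pre\<gamma>, of "\<gamma> x" "h x"] c c\<gamma> Nuc_idem[OF \<gamma> x] meet_absorb
        by (simp add: z_def)
      have "\<gamma> x \<sqinter> f (h x) \<sqsubseteq> f (\<gamma> x) \<sqinter> f (h x)"
        using meet_mono[OF prenucleus_ascending[OF pre(1) c(2)] le_refl[OF cf[OF c(3)]]] c cf by simp
      also have "\<dots> = f z"
        using prenucleus_meet[OF pre(1), of "\<gamma> x" "h x"] c by (simp add: z_def)
      finally have "\<gamma> x \<sqinter> f (h x) \<sqsubseteq> f z" .
      then have "\<gamma> x \<sqinter> f (h x) \<sqsubseteq> \<gamma> z \<sqinter> f z"
        using c cf z by (intro meet_le) (simp_all add: \<gamma>z meet_left)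
      also have "\<gamma> z \<sqinter> f z \<sqsubseteq> \<theta> z"
        using f z unfolding T_def by blast
      also have "\<theta> z \<sqsubseteq> \<theta> (\<theta> x)"
        by (rule prenucleus_mono[OF pre\<theta> z c(4)]) (use h x in \<open>simp add: T_def z_def\<close>)
      finally show ?thesis
        using Nuc_idem[OF \<theta> x] c z cf c\<gamma> c\<theta> by simp
    qed
    then show "f \<circ> h \<in> T"
      using prenucleus_comp[OF pre] by (auto simp: T_def)
  qed
  let ?t = "pointwise_sup L T"
  \<comment> \<open>Directed distributivity carries the defining condition of \<open>T\<close> over
    to its join, which is therefore in \<open>T\<close>.\<close>
  have \<gamma>t: "\<gamma> y \<sqinter> ?t y \<sqsubseteq> \<theta> y" if "y \<in> carrier L" for y
    by (rule T.meet_pointwise_sup_le[OF c\<gamma>[OF that] that c\<theta>[OF that]])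
      (use that in \<open>simp add: T_def\<close>)
  then have "?t \<in> T"
    using T.prenucleus_pointwise_sup by (auto simp: T_def)
  then have t: "?t \<in> carrier (Nuc L)"
    by (rule T.pointwise_sup_in_Nuc)
  have "g \<in> T" if "g \<in> G" for g
    using Nuc_prenucleus[OF subsetD[OF G that]] le that by (simp add: T_def)
  then have "?t \<in> Upper (Nuc L) G"
    using t T.pointwise_sup_upper by (simp add: Upper_def Nuc_le)
  \<comment> \<open>Leastness of \<open>s\<close> enters here: \<open>?t\<close> is a nucleus that
    bounds \<open>G\<close>.\<close>
  from least_le[OF s this] have "s x \<sqsubseteq> ?t x"
    using x by (simp add: Nuc_le)
  moreover have "s x \<in> carrier L"
    using Nuc_closed[OF least_closed[OF s] x] .
  ultimately have "\<gamma> x \<sqinter> s x \<sqsubseteq> \<gamma> x \<sqinter> ?t x"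
    using x c\<gamma> T.pointwise_sup_closed by (intro meet_mono) simp_all
  then show ?thesis
    using \<gamma>t[OF x] by (rule le_trans)
      (use x c\<gamma> c\<theta> T.pointwise_sup_closed \<open>s x \<in> carrier L\<close> in simp_all)
qed

end

section \<open>From pointwise meets to meets in the lattice of nuclei\<close>

theorem theorem5p3:
  fixes P :: "('a, 'b) gorder_scheme"
  assumes "preframe P"
  shows "frame (Nuc P)"
proof -
  interpret preframe P
    by (rule assms)
  interpret N: complete_lattice "Nuc P"
    by (rule Nuc_complete_lattice)
  show ?thesis
  proof
    fix \<gamma> G assume \<gamma>: "\<gamma> \<in> carrier (Nuc P)" and G: "G \<subseteq> carrier (Nuc P)"
    let ?s = "\<Squnion>\<^bsub>Nuc P\<^esub>G" and ?M = "(\<lambda>g. \<gamma> \<sqinter>\<^bsub>Nuc P\<^esub> g) ` G"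
    let ?r = "\<Squnion>\<^bsub>Nuc P\<^esub>?M"
    have M: "?M \<subseteq> carrier (Nuc P)"
      using \<gamma> G by auto
    have s: "?s \<in> carrier (Nuc P)" and r: "?r \<in> carrier (Nuc P)"
      using G M by auto
    have "\<gamma> x \<sqinter>\<^bsub>P\<^esub> g x \<sqsubseteq>\<^bsub>P\<^esub> ?r x" if g: "g \<in> G" and x: "x \<in> carrier P" for g x
    proof -
      \<comment> \<open>The meet of \<gamma> and \<open>g\<close> in \<open>Nuc P\<close> is known
        only as a greatest lower bound. The pointwise meet is a nucleus below both, hence below that
        meet and so below \<open>?r\<close>.\<close>
      let ?m = "\<lambda>x\<in>carrier P. \<gamma> x \<sqinter>\<^bsub>P\<^esub> g x"
      have gN: "g \<in> carrier (Nuc P)"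
        using g G by auto
      have m: "?m \<in> carrier (Nuc P)"
        by (rule pointwise_meet_in_Nuc[OF \<gamma> gN])
      have "?m \<sqsubseteq>\<^bsub>Nuc P\<^esub> \<gamma>" "?m \<sqsubseteq>\<^bsub>Nuc P\<^esub> g"
        using Nuc_closed[OF \<gamma>] Nuc_closed[OF gN]
        by (auto simp: Nuc_le intro: meet_left meet_right)
      then have "?m \<sqsubseteq>\<^bsub>Nuc P\<^esub> \<gamma> \<sqinter>\<^bsub>Nuc P\<^esub> g"
        using m \<gamma> gN by (intro N.meet_le)
      moreover have "\<gamma> \<sqinter>\<^bsub>Nuc P\<^esub> g \<sqsubseteq>\<^bsub>Nuc P\<^esub> ?r"
        using M g by (intro N.sup_upper) auto
      ultimately have "?m \<sqsubseteq>\<^bsub>Nuc P\<^esub> ?r"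
        by (rule N.le_trans) (use m \<gamma> gN r in simp_all)
      then show ?thesis
        using x by (auto simp: Nuc_le)
    qed
    then have distrib: "\<gamma> x \<sqinter>\<^bsub>P\<^esub> ?s x \<sqsubseteq>\<^bsub>P\<^esub> ?r x" if "x \<in> carrier P" for x
      using Nuc_distrib_le[OF G N.sup_lub[OF G] \<gamma> r] that by blast
    show "\<gamma> \<sqinter>\<^bsub>Nuc P\<^esub> ?s = ?r"
    proof (rule N.le_antisym)
      show "\<gamma> \<sqinter>\<^bsub>Nuc P\<^esub> ?s \<sqsubseteq>\<^bsub>Nuc P\<^esub> ?r"
        unfolding Nuc_le
      proof
        fix x assume x: "x \<in> carrier P"
        let ?i = "\<gamma> \<sqinter>\<^bsub>Nuc P\<^esub> ?s"
        have c: "?i x \<in> carrier P" "\<gamma> x \<in> carrier P" "?s x \<in> carrier P" "?r x \<in> carrier P"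
          using Nuc_closed[OF N.meet_closed[OF \<gamma> s] x] Nuc_closed[OF \<gamma> x] Nuc_closed[OF s x]
            Nuc_closed[OF r x] by simp_all
        have "?i x \<sqsubseteq>\<^bsub>P\<^esub> \<gamma> x" "?i x \<sqsubseteq>\<^bsub>P\<^esub> ?s x"
          using N.meet_left[OF \<gamma> s] N.meet_right[OF \<gamma> s] x by (auto simp: Nuc_le)
        \<comment> \<open>Here the lower-bound property of the lattice meet is enough to place its
          values below the pointwise meet.\<close>
        then have "?i x \<sqsubseteq>\<^bsub>P\<^esub> \<gamma> x \<sqinter>\<^bsub>P\<^esub> ?s x"
          using c by (intro meet_le)
        then show "?i x \<sqsubseteq>\<^bsub>P\<^esub> ?r x"
          using distrib[OF x] by (rule le_trans) (use c in simp_all)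
      qed
      \<comment> \<open>This half holds in every complete lattice, by monotonicity of meets.\<close>
      show "?r \<sqsubseteq>\<^bsub>Nuc P\<^esub> \<gamma> \<sqinter>\<^bsub>Nuc P\<^esub> ?s"
      proof (rule N.sup_least[OF M])
        fix m assume "m \<in> ?M"
        then obtain g where g: "g \<in> G" "m = \<gamma> \<sqinter>\<^bsub>Nuc P\<^esub> g"
          by auto
        then have "g \<in> carrier (Nuc P)" "g \<sqsubseteq>\<^bsub>Nuc P\<^esub> ?s"
          using G by (auto intro: N.sup_upper)
        then show "m \<sqsubseteq>\<^bsub>Nuc P\<^esub> \<gamma> \<sqinter>\<^bsub>Nuc P\<^esub> ?s"
          using g \<gamma> s by (auto intro!: N.meet_mono)
      qed (use \<gamma> s in auto)
    qed (use \<gamma> s r in auto)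
  qed
qed

end
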